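(* Let $\mathcal S=(S_n)_{n\ge 0}$ be a linearly recursive matrix sequence in $\mathcal M_p(\mathbb R)$ with minimal polynomial $P_{\mathcal S}$. The following statements are equivalent: (1) $\mathcal S$ admits a representing matrix charge $\mu$; (2) $P_{\mathcal S}$ has real distinct roots (all its roots are real and pairwise distinct). Moreover, when a representing charge $\mu$ exists, $\operatorname{supp}(\mu)=\mathcal Z(P_{\mathcal S})$.
   Context: $\mathcal M_p(\mathbb R)$ is the algebra of real $p\times p$ matrices. A sequence $\mathcal S=(S_n)_{n\ge 0}$ in $\mathcal M_p(\mathbb R)$ is a linearly recursive matrix sequence if there are an integer $r\ge 1$ and real numbers $a_0,\dots,a_{r-1}$ with $a_{r-1}\ne 0$ such that $S_{n+1}=a_0S_n+a_1S_{n-1}+\dots+a_{r-1}S_{n-r+1}$ for all $n\ge r-1$. The polynomial $X^r-a_0X^{r-1}-\dots-a_{r-2}X-a_{r-1}$ is then called a characteristic polynomial of $\mathcal S$; a sequence has many characteristic polynomials, one for each such recurrence (of any order) that it satisfies. The vector space $\mathcal P_{\mathcal S}$ generated by all characteristic polynomials of $\mathcal S$ is an ideal of $\mathbb R[X]$, and the minimal polynomial $P_{\mathcal S}$ is the unique monic polynomial with $\mathcal P_{\mathcal S}=P_{\mathcal S}\,\mathbb R[X]$. $\mathcal Z(P)$ denotes the set of zeros of a polynomial $P$. A matrix charge is a map $\mu=(\mu_{ij})_{1\le i,j\le p}:\mathcal B(\mathbb R)\to\mathcal M_p(\mathbb R)$ on the Borel subsets of $\mathbb R$ whose entries $\mu_{ij}$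 are scalar charges (real signed measures). Integrals are taken entrywise: $\int_{\mathbb R} f\,d\mu=\big(\int_{\mathbb R} f\,d\mu_{ij}\big)_{1\le i,j\le p}$. A matrix charge $\mu$ is a representing matrix charge for $\mathcal S$ if $S_n=\int_{\mathbb R}x^n\,d\mu(x)$ for all $n\ge 0$. The support $\operatorname{supp}(\mu)$ is the smallest closed set $F\subseteq\mathbb R$ such that $\mu(B)=0$ (the zero matrix) for every Borel set $B\subseteq\mathbb R\setminus F$.
   Formalization: Representing charges in (1) and in the "moreover" are required to have compact support; for arbitrary signed measures both (1)⇒(2) and supp(μ)=Z(P_S) fail (Boas 1939; nonzero signed measures on (0,∞) with all moments zero). *)

theory Defs
  imports "HOL-Analysis.Analysis" "HOL-Computational_Algebra.Computational_Algebra"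
begin

section \<open>Linearly recursive matrix sequences\<close>

definition satisfies_recurrence ::
    "(nat \<Rightarrow> real ^ 'p ^ 'p) \<Rightarrow> nat \<Rightarrow> (nat \<Rightarrow> real) \<Rightarrow> bool" where
  "satisfies_recurrence S r a \<longleftrightarrow>
     r \<ge> 1 \<and> a (r - 1) \<noteq> 0 \<and> (\<forall>n \<ge> r - 1. S (n + 1) = (\<Sum>k<r. a k *\<^sub>R S (n - k)))"

definition linearly_recursive :: "(nat \<Rightarrow> real ^ 'p ^ 'p) \<Rightarrow> bool" where
  "linearly_recursive S \<longleftrightarrow> (\<exists>r a. satisfies_recurrence S r a)"

definition recurrence_poly :: "nat \<Rightarrow> (nat \<Rightarrow> real) \<Rightarrow> real poly" where
  "recurrence_poly r a = monom 1 r - (\<Sum>k<r. monom (a k) (r - 1 - k))"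

definition characteristic_polys :: "(nat \<Rightarrow> real ^ 'p ^ 'p) \<Rightarrow> real poly set" where
  "characteristic_polys S = {recurrence_poly r a | r a. satisfies_recurrence S r a}"

interpretation real_poly: vector_space "smult :: real \<Rightarrow> real poly \<Rightarrow> real poly"
  by unfold_locales (simp_all add: smult_add_left smult_add_right)

definition characteristic_ideal :: "(nat \<Rightarrow> real ^ 'p ^ 'p) \<Rightarrow> real poly set" where
  "characteristic_ideal S = real_poly.span (characteristic_polys S)"

definition minimal_poly :: "(nat \<Rightarrow> real ^ 'p ^ 'p) \<Rightarrow> real poly" where
  "minimal_poly S = (THE P. lead_coeff P = 1 \<and> characteristic_ideal S = range (\<lambda>Q. P * Q))"

text \<open>Roots are taken in the complex numbers and counted with multiplicity.\<close>

definition real_distinct_roots :: "real poly \<Rightarrow> bool" where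
  "real_distinct_roots P \<longleftrightarrow>
     (\<forall>z::complex. poly (map_poly complex_of_real P) z = 0 \<longrightarrow>
        z \<in> \<real> \<and> order z (map_poly complex_of_real P) = 1)"

section \<open>Scalar and matrix charges\<close>

text \<open>A real signed measure on the Borel sets of the line; values on non-Borel sets are
  irrelevant. Taking all \<open>A n\<close> empty gives \<open>\<nu> {} = 0\<close>.\<close>

definition scalar_charge :: "(real set \<Rightarrow> real) \<Rightarrow> bool" where
  "scalar_charge \<nu> \<longleftrightarrow>
     (\<forall>A :: nat \<Rightarrow> real set. range A \<subseteq> sets borel \<longrightarrow> disjoint_family A \<longrightarrow>
        (\<lambda>n. \<nu> (A n)) sums \<nu> (\<Union>n. A n))"

text \<open>\<open>M\<close> and \<open>N\<close> are the positive and negative parts of \<open>\<nu>\<close>. Every scalar charge has exactly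
  one such pair (Hahn--Jordan), so the existential in \<open>has_charge_integral\<close> is the usual
  definition of integrability and of the integral with respect to \<open>\<nu>\<close>.\<close>

definition jordan_decomposition ::
    "(real set \<Rightarrow> real) \<Rightarrow> real measure \<Rightarrow> real measure \<Rightarrow> bool" where
  "jordan_decomposition \<nu> M N \<longleftrightarrow>
     finite_measure M \<and> finite_measure N \<and> sets M = sets borel \<and> sets N = sets borel \<and>
     (\<exists>P \<in> sets borel. measure M (- P) = 0 \<and> measure N P = 0) \<and>
     (\<forall>B \<in> sets borel. \<nu> B = measure M B - measure N B)"

definition has_charge_integral ::
    "(real set \<Rightarrow> real) \<Rightarrow> (real \<Rightarrow> real) \<Rightarrow> real \<Rightarrow> bool" where
  "has_charge_integral \<nu> f I \<longleftrightarrow>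
     (\<exists>M N. jordan_decomposition \<nu> M N \<and> integrable M f \<and> integrable N f \<and>
        I = integral\<^sup>L M f - integral\<^sup>L N f)"

definition matrix_charge :: "(real set \<Rightarrow> real ^ 'p ^ 'p) \<Rightarrow> bool" where
  "matrix_charge \<mu> \<longleftrightarrow> (\<forall>i j. scalar_charge (\<lambda>B. \<mu> B $ i $ j))"

definition has_matrix_charge_integral ::
    "(real set \<Rightarrow> real ^ 'p ^ 'p) \<Rightarrow> (real \<Rightarrow> real) \<Rightarrow> real ^ 'p ^ 'p \<Rightarrow> bool" where
  "has_matrix_charge_integral \<mu> f I \<longleftrightarrow>
     (\<forall>i j. has_charge_integral (\<lambda>B. \<mu> B $ i $ j) f (I $ i $ j))"

definition representing_charge ::
    "(real set \<Rightarrow> real ^ 'p ^ 'p) \<Rightarrow> (nat \<Rightarrow> real ^ 'p ^ 'p) \<Rightarrow> bool" where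
  "representing_charge \<mu> S \<longleftrightarrow>
     matrix_charge \<mu> \<and> (\<forall>n. has_matrix_charge_integral \<mu> (\<lambda>x. x ^ n) (S n))"

text \<open>Pitfall: without a restriction on the support, every real sequence is the moment sequence
  of some signed measure (Boas 1939), and that measure is never unique. Statements that recover
  \<open>\<mu>\<close> from its moments therefore need a hypothesis such as compactness of the support.\<close>

text \<open>The order on sets is inclusion; the least such closed set always exists for a matrix
  charge because the line is second countable.\<close>

definition charge_support :: "(real set \<Rightarrow> real ^ 'p ^ 'p) \<Rightarrow> real set" where
  "charge_support \<mu> =
     (LEAST F. closed F \<and> (\<forall>B \<in> sets borel. B \<subseteq> - F \<longrightarrow> \<mu> B = 0))"

end

theory Submission
  imports Defs
begin

text \<open>A polynomial \<open>Q\<close> annihilates \<open>S\<close> under the shift iff all moments of the charge \<open>Q \<mu>\<close>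
  vanish. For compactly supported \<open>\<mu>\<close>, Weierstrass approximation then gives \<open>Q \<mu> = 0\<close>, so \<open>\<mu>\<close> lives on
  the real zeros of \<open>P = P\<^sub>S\<close>. Thus \<open>\<mu>\<close> is a finite sum of point masses, \<open>S\<close> is annihilated by the
  product of \<open>X - x\<close> over \<open>x \<in> supp \<mu>\<close>, and \<open>P\<close> divides this product. Conversely, if \<open>P\<close> has
  real distinct roots, Lagrange interpolation writes \<open>S\<^sub>n\<close> as a combination of the \<open>x ^ n\<close>,
  whose coefficients are the point masses of a representing charge.\<close>

section \<open>The annihilator ideal of a sequence\<close>

text \<open>This is \<open>(Q(E) S) n\<close> for the shift operator \<open>E\<close>, which sends
  \<open>S\<close> to \<open>\<lambda>n. S (n + 1)\<close>.\<close>

definition shift_apply :: "real poly \<Rightarrow> (nat \<Rightarrow> 'a::real_vector) \<Rightarrow> nat \<Rightarrow> 'a" where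
  "shift_apply Q S n = (\<Sum>i\<le>degree Q. coeff Q i *\<^sub>R S (n + i))"

text \<open>Frees the range of summation from the degree, so that polynomials of different degrees
  can be compared on one common range.\<close>

lemma shift_apply_bound:
  assumes "degree Q \<le> N"
  shows "shift_apply Q S n = (\<Sum>i\<le>N. coeff Q i *\<^sub>R S (n + i))"
  unfolding shift_apply_def
  by (rule sum.mono_neutral_left) (use assms in \<open>auto simp: coeff_eq_0\<close>)

lemma shift_apply_add: "shift_apply (P + Q) S n = shift_apply P S n + shift_apply Q S n"
proof -
  let ?N = "max (degree P) (degree Q)"
  have "degree (P + Q) \<le> ?N"
    by (rule degree_add_le_max)
  then show ?thesis
    by (simp add: shift_apply_bound[of _ ?N] scaleR_add_left sum.distrib)
qed

lemma shift_apply_smult: "shift_apply (smult c Q) S n = c *\<^sub>R shift_apply Q S n"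
  by (simp add: shift_apply_bound[of "smult c Q" "degree Q"] degree_smult_le
      shift_apply_bound[of Q "degree Q"] scaleR_sum_right)

lemma shift_apply_diff: "shift_apply (P - Q) S n = shift_apply P S n - shift_apply Q S n"
  using shift_apply_add[of P "smult (-1) Q" S n] shift_apply_smult[of "-1" Q S n] by simp

lemma shift_apply_0 [simp]: "shift_apply 0 S n = 0"
  by (simp add: shift_apply_def)

lemma shift_apply_sum: "shift_apply (\<Sum>k\<in>A. Q k) S n = (\<Sum>k\<in>A. shift_apply (Q k) S n)"
  by (induction A rule: infinite_finite_induct) (simp_all add: shift_apply_add)

lemma shift_apply_monom [simp]: "shift_apply (monom c m) S n = c *\<^sub>R S (n + m)"
proof -
  have "shift_apply (monom c m) S n = (\<Sum>i\<le>m. coeff (monom c m) i *\<^sub>R S (n + i))"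
    by (rule shift_apply_bound) (rule degree_monom_le)
  also have "\<dots> = (\<Sum>i\<le>m. if i = m then c *\<^sub>R S (n + i) else 0)"
    by (rule sum.cong) auto
  finally show ?thesis
    by simp
qed

lemma shift_apply_pCons: "shift_apply (pCons c Q) S n = c *\<^sub>R S n + shift_apply Q S (Suc n)"
  by (simp add: shift_apply_bound[of "pCons c Q" "Suc (degree Q)"] degree_pCons_le
      shift_apply_bound[of Q "degree Q"] sum.atMost_Suc_shift del: sum.atMost_Suc)

definition annihilates :: "real poly \<Rightarrow> (nat \<Rightarrow> 'a::real_vector) \<Rightarrow> bool" where
  "annihilates Q S \<longleftrightarrow> (\<forall>n. shift_apply Q S n = 0)"

lemma annihilates_add: "annihilates P S \<Longrightarrow> annihilates Q S \<Longrightarrow> annihilates (P + Q) S"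
  by (simp add: annihilates_def shift_apply_add)

lemma annihilates_diff: "annihilates P S \<Longrightarrow> annihilates Q S \<Longrightarrow> annihilates (P - Q) S"
  by (simp add: annihilates_def shift_apply_diff)

lemma annihilates_smult: "annihilates Q S \<Longrightarrow> annihilates (smult c Q) S"
  by (simp add: annihilates_def shift_apply_smult)

text \<open>Multiplying by X only moves the evaluation from \<open>n\<close> to
  \<open>Suc n\<close>, and \<open>annihilates\<close> asks for zero at every index. With closure
  under sums, the annihilator is an ideal.\<close>

lemma annihilates_mult: "annihilates Q S \<Longrightarrow> annihilates (P * Q) S"
proof (induction P)
  case 0
  then show ?case by (simp add: annihilates_def)
next
  case (pCons a P)
  then have "annihilates (pCons 0 (P * Q)) S"
    by (simp add: annihilates_def shift_apply_pCons)
  with pCons show ?case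
    by (simp add: annihilates_add annihilates_smult)
qed

section \<open>Recurrences as annihilating polynomials\<close>

lemma shift_apply_recurrence_poly:
  "shift_apply (recurrence_poly r a) S n = S (n + r) - (\<Sum>k<r. a k *\<^sub>R S (n + (r - 1 - k)))"
  by (simp add: recurrence_poly_def shift_apply_diff shift_apply_sum)

lemma satisfies_recurrence_iff:
  "satisfies_recurrence S r a \<longleftrightarrow> r \<ge> 1 \<and> a (r - 1) \<noteq> 0 \<and> annihilates (recurrence_poly r a) S"
proof (cases "r \<ge> 1")
  case True
  have "(\<forall>n \<ge> r - 1. S (n + 1) = (\<Sum>k<r. a k *\<^sub>R S (n - k)))
     \<longleftrightarrow> (\<forall>n. S (n + r) = (\<Sum>k<r. a k *\<^sub>R S (n + (r - 1 - k))))" (is "?L = ?R")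
  proof
    assume L: ?L
    show ?R
    proof
      fix n
      \<comment> \<open>The indices \<open>n + (r - 1)\<close> are exactly those from
        \<open>r - 1\<close> on. Since \<open>k < r\<close>, no subtraction is truncated when
        \<open>r - 1 - k\<close> is regrouped.\<close>
      have "S (n + (r - 1) + 1) = (\<Sum>k<r. a k *\<^sub>R S (n + (r - 1) - k))"
        using L by simp
      also have "\<dots> = (\<Sum>k<r. a k *\<^sub>R S (n + (r - 1 - k)))"
        by (intro sum.cong) auto
      finally show "S (n + r) = (\<Sum>k<r. a k *\<^sub>R S (n + (r - 1 - k)))"
        using True by simp
    qed
  next
    assume R: ?R
    show ?L
    proof (intro allI impI)
      fix n assume n: "n \<ge> r - 1"
      have "S (n - (r - 1) + r) = (\<Sum>k<r. a k *\<^sub>R S (n - (r - 1) + (r - 1 - k)))"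
        using R by blast
      also have "\<dots> = (\<Sum>k<r. a k *\<^sub>R S (n - k))"
        using n by (intro sum.cong) auto
      finally show "S (n + 1) = (\<Sum>k<r. a k *\<^sub>R S (n - k))"
        using True n by (simp add: Suc_diff_le)
    qed
  qed
  then show ?thesis
    by (simp add: satisfies_recurrence_def annihilates_def shift_apply_recurrence_poly)
qed (simp add: satisfies_recurrence_def)

lemma coeff_recurrence_poly:
  "coeff (recurrence_poly r a) i = (if i = r then 1 else if i < r then - a (r - 1 - i) else 0)"
proof -
  \<comment> \<open>Only \<open>k = r - 1 - i\<close> can contribute. The inner test
    \<open>i < r\<close> blocks a false hit at \<open>k = 0\<close>, where \<open>r - 1 - i\<close>
    is truncated.\<close>
  have "(\<Sum>k<r. coeff (monom (a k) (r - 1 - k)) i)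
      = (\<Sum>k<r. if k = r - 1 - i then if i < r then a k else 0 else 0)"
    by (intro sum.cong) auto
  also have "\<dots> = (if i < r then a (r - 1 - i) else 0)"
    by (subst sum.delta) auto
  finally show ?thesis
    by (auto simp: recurrence_poly_def coeff_sum)
qed

lemma degree_recurrence_poly: "degree (recurrence_poly r a) = r"
  by (rule antisym[OF degree_le le_degree]) (auto simp: coeff_recurrence_poly)

text \<open>The condition \<open>a (r - 1) \<noteq> 0\<close> turns into a nonzero constant
  coefficient and \<open>r \<ge> 1\<close> into a positive degree, so membership becomes a property
  of the polynomial alone, free of \<open>r\<close> and \<open>a\<close>.\<close>

lemma characteristic_polys_eq:
  "characteristic_polys S
     = {Q. lead_coeff Q = 1 \<and> degree Q \<ge> 1 \<and> coeff Q 0 \<noteq> 0 \<and> annihilates Q S}" (is "?L = ?R")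
proof
  show "?L \<subseteq> ?R"
    by (auto simp: characteristic_polys_def satisfies_recurrence_iff degree_recurrence_poly
        coeff_recurrence_poly)
  show "?R \<subseteq> ?L"
  proof
    fix Q assume Q: "Q \<in> ?R"
    let ?a = "\<lambda>k. - coeff Q (degree Q - 1 - k)"
    have eq: "recurrence_poly (degree Q) ?a = Q"
      by (rule poly_eqI) (use Q in \<open>auto simp: coeff_recurrence_poly coeff_eq_0\<close>)
    then have "satisfies_recurrence S (degree Q) ?a"
      using Q by (simp add: satisfies_recurrence_iff)
    then show "Q \<in> ?L"
      unfolding characteristic_polys_def using eq by force
  qed
qed

lemma linearly_recursive_iff: "linearly_recursive S \<longleftrightarrow> characteristic_polys S \<noteq> {}"
  by (auto simp: linearly_recursive_def characteristic_polys_def)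

text \<open>Linear recursiveness supplies a first annihilator \<open>P\<close> with nonzero constant
  coefficient. The sequence \<open>C, 0, 0, ...\<close> with \<open>C \<noteq> 0\<close> is
  annihilated by X but has no characteristic polynomial, so its span is too small.\<close>

lemma characteristic_ideal_eq:
  assumes "linearly_recursive S"
  shows "characteristic_ideal S = {Q. annihilates Q S}"
proof
  have "real_poly.subspace {Q. annihilates Q S}"
    by (auto intro!: real_poly.subspaceI annihilates_add annihilates_smult simp: annihilates_def
        shift_apply_add shift_apply_smult)
  then show "characteristic_ideal S \<subseteq> {Q. annihilates Q S}"
    unfolding characteristic_ideal_def
    by (rule real_poly.span_minimal[rotated]) (auto simp: characteristic_polys_eq)
next
  obtain P where P: "lead_coeff P = 1" "degree P \<ge> 1" "coeff P 0 \<noteq> 0" "annihilates P S"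
    using assms by (auto simp: linearly_recursive_iff characteristic_polys_eq)
  show "{Q. annihilates Q S} \<subseteq> characteristic_ideal S"
  proof
    fix Q assume "Q \<in> {Q. annihilates Q S}"
    then have Q: "annihilates Q S" by simp
    txt \<open>\<open>Q\<close> need not be a characteristic polynomial (\<open>coeff Q 0\<close> may vanish), but it is the
      difference of the two characteristic polynomials \<open>A + Q\<close> and \<open>A\<close>.\<close>
    define m where "m = Suc (degree Q)"
    \<comment> \<open>If \<open>coeff P 0 + coeff Q 0\<close> vanishes, then
      \<open>2 * coeff P 0 + coeff Q 0 = coeff P 0 \<noteq> 0\<close>; so one of the factors 1 and 2
      always keeps both constant coefficients nonzero.\<close>
    define t where "t = (if coeff P 0 + coeff Q 0 = 0 then 2 else 1 :: real)"
    \<comment> \<open>The summand \<open>monom 1 m * P\<close> is monic, of degree above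
      \<open>P\<close> and \<open>Q\<close>, and has constant coefficient 0. It fixes the leading
      term, while \<open>smult t P\<close> governs the constant one.\<close>
    define A where "A = monom 1 m * P + smult t P"
    have t: "t * coeff P 0 \<noteq> 0" "t * coeff P 0 + coeff Q 0 \<noteq> 0"
      using P(3) by (auto simp: t_def)
    have P0: "P \<noteq> 0" using P(1) by auto
    have dmP: "degree (monom 1 m * P) = m + degree P"
      using P0 by (simp add: degree_mult_eq degree_monom_eq)
    have char: "A + R \<in> characteristic_polys S"
      if R: "degree R < m" "t * coeff P 0 + coeff R 0 \<noteq> 0" "annihilates R S" for R
    proof -
      have "degree (smult t P + R) < degree (monom 1 m * P)"
        unfolding dmP using R(1) P(2) degree_smult_le[of t P]
        by (intro degree_add_less) (auto simp: m_def)
      then have deg: "degree (A + R) = m + degree P"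
        and "coeff (smult t P + R) (m + degree P) = 0"
        using dmP by (simp_all only: A_def add.assoc degree_add_eq_left coeff_eq_0)
      then have "lead_coeff (A + R) = coeff (monom 1 m * P) (m + degree P)"
        by (simp only: A_def add.assoc coeff_add)
      then have "lead_coeff (A + R) = 1"
        using P(1) by (simp add: coeff_monom_mult)
      note deg this
      moreover have "coeff (A + R) 0 \<noteq> 0"
        using R(2) by (simp add: A_def m_def mult_monom coeff_monom_mult)
      moreover have "annihilates (A + R) S"
        unfolding A_def by (intro annihilates_add annihilates_mult annihilates_smult P(4) R(3))
      ultimately show ?thesis
        by (simp add: characteristic_polys_eq m_def)
    qed
    have "A + Q \<in> characteristic_polys S" "A + 0 \<in> characteristic_polys S"
      using Q t by (intro char; simp add: m_def annihilates_def)+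
    then have "(A + Q) - (A + 0) \<in> characteristic_ideal S"
      unfolding characteristic_ideal_def
      by (intro real_poly.span_diff real_poly.span_base)
    then show "Q \<in> characteristic_ideal S"
      by simp
  qed
qed

text \<open>A nonzero annihilator of least degree divides all others, because remainders are again
  annihilators. Made monic, it is the only candidate for the \<open>THE\<close>: monic polynomials
  that divide each other coincide.\<close>

lemma minimal_poly:
  assumes "linearly_recursive S"
  shows "lead_coeff (minimal_poly S) = 1"
    and "annihilates Q S \<longleftrightarrow> minimal_poly S dvd Q"
proof -
  obtain P where "lead_coeff P = 1" "annihilates P S"
    using assms by (auto simp: linearly_recursive_iff characteristic_polys_eq)
  then have "P \<noteq> 0" "annihilates P S"
    by auto
  then obtain P where P: "P \<noteq> 0" "annihilates P S"
    and least: "\<And>Q. Q \<noteq> 0 \<Longrightarrow> annihilates Q S \<Longrightarrow> degree P \<le> degree Q"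
    using ex_has_least_nat[of "\<lambda>P. P \<noteq> 0 \<and> annihilates P S" P degree] by blast
  define P1 where "P1 = smult (inverse (lead_coeff P)) P"
  have P1: "lead_coeff P1 = 1"
    using P(1) by (simp add: P1_def)
  have ann: "annihilates Q S \<longleftrightarrow> P1 dvd Q" for Q
  proof
    assume Q: "annihilates Q S"
    have "annihilates (Q - (Q div P) * P) S"
      by (intro annihilates_diff annihilates_mult Q P)
    then have "annihilates (Q mod P) S"
      by (simp add: minus_div_mult_eq_mod)
    then have "Q mod P = 0 \<or> degree P \<le> degree (Q mod P)"
      using least by blast
    then have "P dvd Q"
      using degree_mod_less_degree[OF P(1), of Q] mod_eq_0_iff_dvd[of Q P] by linarith
    then show "P1 dvd Q"
      using P(1) by (simp add: P1_def smult_dvd_iff)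
  next
    assume "P1 dvd Q"
    then have "P dvd Q"
      using P(1) by (simp add: P1_def smult_dvd_iff)
    then show "annihilates Q S"
      using annihilates_mult[OF P(2)] by (auto simp: dvd_def mult.commute)
  qed
  have ideal: "characteristic_ideal S = range (\<lambda>Q. R * Q) \<longleftrightarrow> (\<forall>Q. P1 dvd Q \<longleftrightarrow> R dvd Q)" for R
    unfolding characteristic_ideal_eq[OF assms] ann by (auto simp: set_eq_iff image_iff dvd_def)
  have "minimal_poly S = P1"
    unfolding minimal_poly_def ideal
  proof (rule the_equality)
    fix R assume R: "lead_coeff R = 1 \<and> (\<forall>Q. P1 dvd Q \<longleftrightarrow> R dvd Q)"
    then have dvd: "P1 dvd R" "R dvd P1"
      using dvd_refl by blast+
    from dvd(1) obtain K where K: "R = P1 * K"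
      by (rule dvdE)
    have "P1 \<noteq> 0"
      using P1 by auto
    with dvd(2) have "degree R \<le> degree P1"
      by (rule dvd_imp_degree_le)
    then have "degree K = 0"
      using R K by (cases "P1 = 0 \<or> K = 0") (auto simp: degree_mult_eq)
    moreover have "lead_coeff K = 1"
      using R K P1 by (simp add: lead_coeff_mult)
    ultimately have "K = 1"
      by (auto elim!: degree_eq_zeroE simp: one_pCons)
    then show "R = P1"
      using K by simp
  qed (use P1 in simp)
  then show "lead_coeff (minimal_poly S) = 1" "annihilates Q S \<longleftrightarrow> minimal_poly S dvd Q"
    using P1 ann by auto
qed

section \<open>Polynomials with real distinct roots\<close>

lemma map_poly_of_real_mult:
  "map_poly complex_of_real (p * q) = map_poly complex_of_real p * map_poly complex_of_real q"
  by (rule poly_eqI) (simp add: coeff_map_poly coeff_mult)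

lemma poly_map_poly_of_real:
  "poly (map_poly complex_of_real p) (complex_of_real x) = complex_of_real (poly p x)"
  by (induction p) (simp_all add: map_poly_pCons)

lemma degree_map_poly_of_real: "degree (map_poly complex_of_real p) = degree p"
  by (rule degree_map_poly) simp

text \<open>A root \<open>x \<noteq> a\<close> of \<open>[:-a, 1:] * G\<close> is a root of
  \<open>G\<close>, so distinct roots can be divided out one after another.\<close>

lemma prod_linear_dvd:
  fixes P :: "real poly"
  assumes "finite Z" "\<And>x. x \<in> Z \<Longrightarrow> poly P x = 0"
  shows "(\<Prod>x\<in>Z. [:-x, 1:]) dvd P"
  using assms
proof (induction Z arbitrary: P rule: finite_induct)
  case (insert a Z)
  then obtain G where G: "P = [:-a, 1:] * G"
    by (metis dvdE insertI1 poly_eq_0_iff_dvd)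
  have "poly G x = 0" if "x \<in> Z" for x
  proof -
    have "x \<noteq> a" using insert.hyps that by auto
    then show ?thesis using insert.prems[of x] that G by simp
  qed
  then have "(\<Prod>x\<in>Z. [:-x, 1:]) dvd G"
    by (rule insert.IH)
  then show ?case
    using insert.hyps G by (simp add: mult_dvd_mono del: mult_pCons_left)
qed simp

text \<open>Over the complex numbers the orders of \<open>P\<close> and its cofactor at
  \<open>z\<close> add up to the order of the product, which is 1 at each of its roots, and these
  are all real.\<close>

lemma real_distinct_roots_dvd_prod:
  assumes "finite T" "P dvd (\<Prod>x\<in>T. [:-x, 1:])"
  shows "real_distinct_roots P" and "{x. poly P x = 0} \<subseteq> T"
proof -
  obtain G where G: "(\<Prod>x\<in>T. [:-x, 1:]) = P * G"
    using assms(2) by (auto simp: dvd_def)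
  show "{x. poly P x = 0} \<subseteq> T"
  proof
    fix x assume "x \<in> {x. poly P x = 0}"
    then have "poly (\<Prod>x\<in>T. [:-x, 1:]) x = 0"
      by (simp add: G)
    then show "x \<in> T"
      using assms(1) by (auto simp: poly_prod)
  qed
  define c :: "real \<Rightarrow> complex" where "c = complex_of_real"
  let ?P = "map_poly complex_of_real P" and ?G = "map_poly complex_of_real G"
  have "map_poly complex_of_real (\<Prod>x\<in>T. [:-x, 1:]) = (\<Prod>x\<in>T. [:- c x, 1:])"
    using assms(1)
    by (induction T rule: finite_induct)
      (simp_all add: map_poly_of_real_mult map_poly_pCons c_def del: mult_pCons_left)
  also have "(\<Prod>x\<in>T. [:- c x, 1:]) = (\<Prod>z\<in>c ` T. [:- z, 1:])"
    by (subst prod.reindex) (auto simp: c_def inj_on_def)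
  finally have PG: "?P * ?G = (\<Prod>z\<in>c ` T. [:- z, 1:])"
    by (simp add: G map_poly_of_real_mult)
  have fin: "finite (c ` T)" using assms(1) by simp
  have ne: "(\<Prod>z\<in>c ` T. [:- z, 1:]) \<noteq> (0 :: complex poly)"
    using fin by (simp add: prod_zero_iff)
  show "real_distinct_roots P"
    unfolding real_distinct_roots_def
  proof (intro allI impI)
    fix z assume z: "poly ?P z = 0"
    have "poly (\<Prod>z\<in>c ` T. [:- z, 1:]) z = 0"
      using z by (simp flip: PG)
    then have zT: "z \<in> c ` T"
      using fin by (auto simp: poly_prod)
    then have "?P * ?G = [:- z, 1:] * (\<Prod>w\<in>c ` T - {z}. [:- w, 1:])"
      unfolding PG by (intro prod.remove fin)
    then have "order z ?P + order z ?G
        = order z [:- z, 1:] + order z (\<Prod>w\<in>c ` T - {z}. [:- w, 1:])"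
      using ne PG by (metis order_mult)
    moreover have "order z (\<Prod>w\<in>c ` T - {z}. [:- w, 1:]) = 0"
      using fin by (intro order_0I) (auto simp: poly_prod prod_zero_iff)
    moreover have "order z [:- z, 1:] = 1"
      using order_power_n_n[of z 1] by simp
    ultimately have "order z ?P + order z ?G = 1"
      by simp
    moreover have "order z ?P \<noteq> 0"
      using z ne PG by (metis mult_zero_left order_root)
    ultimately show "z \<in> \<real> \<and> order z ?P = 1"
      using zT by (auto simp: c_def)
  qed
qed

text \<open>Divide all real root factors out of \<open>P\<close>. A nonconstant cofactor would have
  a complex root; as a root of \<open>P\<close> it is real and already divided out once, so its
  order in \<open>P\<close> would be at least 2.\<close>

lemma real_distinct_roots_eq_prod:
  assumes "lead_coeff P = 1" "real_distinct_roots P"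
  shows "P = (\<Prod>x\<in>{x. poly P x = 0}. [:-x, 1:])"
proof -
  define Z where "Z = {x. poly P x = 0}"
  have P0: "P \<noteq> 0" using assms(1) by auto
  then have Z: "finite Z"
    unfolding Z_def by (rule poly_roots_finite)
  obtain G where G: "P = (\<Prod>x\<in>Z. [:-x, 1:]) * G"
    using prod_linear_dvd[OF Z, of P] by (auto simp: Z_def dvd_def)
  have "degree G = 0"
  proof (rule ccontr)
    let ?G = "map_poly complex_of_real G"
    assume "degree G \<noteq> 0"
    then have "\<not> constant (poly ?G)"
      by (simp add: constant_degree degree_map_poly_of_real)
    then obtain z where z: "poly ?G z = 0"
      using fundamental_theorem_of_algebra by blast
    then have Pz: "poly (map_poly complex_of_real P) z = 0"
      by (subst G) (simp add: map_poly_of_real_mult)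
    then have "z \<in> \<real>" and ord: "order z (map_poly complex_of_real P) = 1"
      using assms(2) by (auto simp: real_distinct_roots_def)
    then obtain x where x: "z = complex_of_real x"
      by (auto elim: Reals_cases)
    have "poly G x = 0" "x \<in> Z"
      using z Pz by (auto simp: x poly_map_poly_of_real Z_def)
    then obtain G' where "G = [:-x, 1:] * G'"
      by (metis dvdE poly_eq_0_iff_dvd)
    moreover have "(\<Prod>x\<in>Z. [:-x, 1:]) = [:-x, 1:] * (\<Prod>x\<in>Z - {x}. [:-x, 1:])"
      using Z \<open>x \<in> Z\<close> by (rule prod.remove)
    ultimately have "P = [:-x, 1:] ^ 2 * ((\<Prod>x\<in>Z - {x}. [:-x, 1:]) * G')"
      using G by (simp add: power2_eq_square mult_ac del: mult_pCons_left mult_pCons_right)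
    then have "map_poly complex_of_real P
        = [:-z, 1:] ^ 2 * map_poly complex_of_real ((\<Prod>x\<in>Z - {x}. [:-x, 1:]) * G')"
      by (simp add: power2_eq_square map_poly_of_real_mult map_poly_pCons x
          del: mult_pCons_left mult_pCons_right)
    then have "[:-z, 1:] ^ 2 dvd map_poly complex_of_real P"
      by simp
    moreover have "map_poly complex_of_real P \<noteq> 0"
      using P0 by (simp add: map_poly_eq_0_iff)
    ultimately have "2 \<le> order z (map_poly complex_of_real P)"
      by (simp add: order_divides)
    with ord show False by simp
  qed
  then obtain g where g: "G = [:g:]"
    by (rule degree_eq_zeroE)
  have "lead_coeff P = lead_coeff (\<Prod>x\<in>Z. [:-x, 1:]) * lead_coeff G"
    using lead_coeff_mult G by metis
  also have "lead_coeff (\<Prod>x\<in>Z. [:-x, 1:]) = 1"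
    by (simp add: lead_coeff_prod)
  finally have "G = 1"
    using assms(1) g by (simp add: one_pCons)
  then show ?thesis
    using G by (simp add: Z_def)
qed

section \<open>Exponential sums and products of distinct linear factors\<close>

lemma annihilates_prod_imp_exponential_sum:
  fixes S :: "nat \<Rightarrow> 'a::real_vector"
  assumes Z: "finite Z" and ann: "annihilates (\<Prod>x\<in>Z. [:-x, 1:]) S"
  obtains C where "\<And>n. S n = (\<Sum>x\<in>Z. x ^ n *\<^sub>R C x)"
proof -
  \<comment> \<open>The Lagrange basis polynomials of the nodes \<open>Z\<close>.\<close>
  define L where "L x = (\<Prod>y\<in>Z - {x}. smult (inverse (x - y)) [:-y, 1:])" for x
  have L: "poly (L x) w = (if w = x then 1 else 0)" if "x \<in> Z" "w \<in> Z" for x w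
  proof (cases "w = x")
    case True
    have "poly (L x) x = (\<Prod>y\<in>Z - {x}. inverse (x - y) * (x - y))"
      by (simp add: L_def poly_prod algebra_simps)
    also have "\<dots> = 1"
      by (rule prod.neutral) auto
    finally show ?thesis
      using True by simp
  next
    case False
    then show ?thesis
      using that Z by (auto simp: L_def poly_prod prod_zero_iff)
  qed
  have "S n = (\<Sum>x\<in>Z. x ^ n *\<^sub>R shift_apply (L x) S 0)" for n
  proof -
    \<comment> \<open>The error of interpolating X^n on \<open>Z\<close>. It vanishes on
      \<open>Z\<close>, so it is a multiple of the annihilating product; evaluating it at index 0
      isolates \<open>S n\<close>, with coefficients that do not depend on \<open>n\<close>.\<close>
    define R where "R = monom 1 n - (\<Sum>x\<in>Z. smult (x ^ n) (L x))"
    have "poly R w = 0" if "w \<in> Z" for w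
    proof -
      have "(\<Sum>x\<in>Z. x ^ n * poly (L x) w) = (\<Sum>x\<in>Z. if x = w then x ^ n else 0)"
        using that by (intro sum.cong) (auto simp: L)
      then show ?thesis
        using that Z by (simp add: R_def poly_sum poly_monom)
    qed
    then have "(\<Prod>x\<in>Z. [:-x, 1:]) dvd R"
      using Z by (intro prod_linear_dvd) auto
    then have "annihilates R S"
      using annihilates_mult[OF ann] by (auto simp: dvd_def mult.commute)
    then have "shift_apply R S 0 = 0"
      by (simp add: annihilates_def)
    then show ?thesis
      by (simp add: R_def shift_apply_diff shift_apply_sum shift_apply_smult)
  qed
  then show thesis
    by (rule that)
qed

text \<open>Geometric sequences are eigenvectors of the shift: \<open>Q\<close> multiplies the term
  of ratio \<open>x\<close> by \<open>poly Q x\<close>, which is zero for each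
  \<open>x \<in> T\<close> when \<open>Q\<close> is the product.\<close>

lemma exponential_sum_imp_annihilates_prod:
  fixes S :: "nat \<Rightarrow> 'a::real_vector"
  assumes "finite T" and S: "\<And>n. S n = (\<Sum>x\<in>T. x ^ n *\<^sub>R C x)"
  shows "annihilates (\<Prod>x\<in>T. [:-x, 1:]) S"
proof -
  have eq: "shift_apply Q S n = (\<Sum>x\<in>T. (x ^ n * poly Q x) *\<^sub>R C x)" for Q n
  proof (induction Q arbitrary: n)
    case (pCons a Q)
    have "shift_apply (pCons a Q) S n
        = a *\<^sub>R (\<Sum>x\<in>T. x ^ n *\<^sub>R C x) + (\<Sum>x\<in>T. (x ^ Suc n * poly Q x) *\<^sub>R C x)"
      by (simp only: shift_apply_pCons pCons.IH S[of n])
    then show ?case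
      by (simp add: sum.distrib scaleR_sum_right algebra_simps)
  qed simp
  show ?thesis
    unfolding annihilates_def eq
    using assms(1) by (auto intro!: sum.neutral simp: poly_prod prod_zero_iff)
qed

section \<open>Supports and Jordan decompositions of charges\<close>

lemma scalar_charge_empty:
  assumes "scalar_charge \<nu>"
  shows "\<nu> {} = 0"
proof -
  have "(\<lambda>n::nat. \<nu> {}) sums \<nu> (\<Union>n::nat. {})"
    using assms unfolding scalar_charge_def by (force simp: disjoint_family_on_def)
  then have "(\<lambda>n::nat. \<nu> {}) \<longlonglongrightarrow> 0"
    using sums_summable summable_LIMSEQ_zero by blast
  then show ?thesis
    by (simp add: LIMSEQ_const_iff)
qed

definition charge_null_outside :: "(real set \<Rightarrow> real ^ 'p ^ 'p) \<Rightarrow> real set \<Rightarrow> bool" where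
  "charge_null_outside \<mu> F \<longleftrightarrow> (\<forall>B \<in> sets borel. B \<subseteq> - F \<longrightarrow> \<mu> B = 0)"

text \<open>By Lindelof, the union of all null open sets is a countable one. Made disjoint, it cuts
  each Borel subset into countably many null pieces, and countable additivity applies. A signed
  charge may vanish on a set but not on its subsets, hence nullity is required of all Borel
  subsets.\<close>

lemma charge_null_outside_support:
  assumes "matrix_charge \<mu>"
  shows "closed (charge_support \<mu>)" "charge_null_outside \<mu> (charge_support \<mu>)"
    and "\<And>F. closed F \<Longrightarrow> charge_null_outside \<mu> F \<Longrightarrow> charge_support \<mu> \<subseteq> F"
proof -
  define \<F> where "\<F> = {F. closed F \<and> charge_null_outside \<mu> F}"
  have charge: "scalar_charge (\<lambda>B. \<mu> B $ i $ j)" for i j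
    using assms by (simp add: matrix_charge_def)
  have empty: "\<mu> {} = 0"
    using scalar_charge_empty[OF charge] by (simp add: vec_eq_iff)
  have "open U" if "U \<in> uminus ` \<F>" for U
    using that by (auto simp: \<F>_def)
  then obtain \<U> where \<U>: "\<U> \<subseteq> uminus ` \<F>" "countable \<U>" "\<Union>\<U> = \<Union>(uminus ` \<F>)"
    using Lindelof[of "uminus ` \<F>"] by blast
  \<comment> \<open>Inserting the empty set makes the family nonempty, so that the naturals can
    enumerate it.\<close>
  define U where "U = from_nat_into (insert {} \<U>)"
  have "range U = insert {} \<U>"
    unfolding U_def using \<U>(2) by (intro range_from_nat_into) auto
  moreover have "\<Union>(uminus ` \<F>) = - \<Inter>\<F>"
    by auto
  ultimately have U_Un: "(\<Union>n. U n) = - \<Inter>\<F>"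
    using \<U>(3) by simp
  have U: "U n = {} \<or> (\<exists>F\<in>\<F>. U n = - F)" for n
  proof -
    have "U n \<in> insert {} \<U>"
      using \<open>range U = insert {} \<U>\<close> by blast
    then show ?thesis
      using \<U>(1) by blast
  qed
  have "open (U n)" for n
    using U[of n] by (auto simp: \<F>_def)
  then have U_borel: "disjointed U n \<in> sets borel" for n
    using sets.range_disjointed_sets[of U borel] by (auto simp: image_subset_iff)
  have "charge_null_outside \<mu> (\<Inter>\<F>)"
    unfolding charge_null_outside_def
  proof (intro ballI impI)
    fix B :: "real set" assume B: "B \<in> sets borel" "B \<subseteq> - \<Inter>\<F>"
    define A where "A n = B \<inter> disjointed U n" for n
    have A: "range A \<subseteq> sets borel" "disjoint_family A"
      using B(1) U_borel disjoint_family_disjointed[of U]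
      by (auto simp: A_def disjoint_family_on_def)
    have "(\<Union>n. A n) = B \<inter> (\<Union>n. disjointed U n)"
      by (auto simp: A_def)
    also have "\<dots> = B"
      using B(2) by (auto simp: UN_disjointed_eq U_Un)
    finally have Un: "(\<Union>n. A n) = B" .
    have null: "\<mu> (A n) = 0" for n
      using U[of n]
    proof
      assume "U n = {}"
      then have "A n = {}"
        using disjointed_subset[of U n] by (auto simp: A_def)
      then show ?thesis
        using empty by simp
    next
      assume "\<exists>F\<in>\<F>. U n = - F"
      then obtain F where "charge_null_outside \<mu> F" "U n = - F"
        by (auto simp: \<F>_def)
      moreover from this have "A n \<subseteq> - F"
        using disjointed_subset[of U n] by (auto simp: A_def)
      moreover have "A n \<in> sets borel"
        using A(1) by blast
      ultimately show ?thesis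
        by (simp add: charge_null_outside_def)
    qed
    have "\<mu> B $ i $ j = 0" for i j
    proof -
      have "(\<lambda>n. \<mu> (A n) $ i $ j) sums (\<mu> B $ i $ j)"
        using charge[of i j] A unfolding scalar_charge_def Un[symmetric] by blast
      then show ?thesis
        using sums_unique2[OF _ sums_zero] by (simp add: null)
    qed
    then show "\<mu> B = 0"
      by (simp add: vec_eq_iff)
  qed
  moreover have "closed (\<Inter>\<F>)"
    by (auto simp: \<F>_def)
  ultimately have "\<Inter>\<F> \<in> \<F>"
    by (simp add: \<F>_def)
  moreover have "charge_support \<mu> = \<Inter>\<F>"
    unfolding charge_support_def charge_null_outside_def[symmetric]
    by (rule Least_equality) (use \<open>\<Inter>\<F> \<in> \<F>\<close> in \<open>auto simp: \<F>_def\<close>)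
  ultimately show "closed (charge_support \<mu>)" "charge_null_outside \<mu> (charge_support \<mu>)"
    "\<And>F. closed F \<Longrightarrow> charge_null_outside \<mu> F \<Longrightarrow> charge_support \<mu> \<subseteq> F"
    by (auto simp: \<F>_def)
qed

section \<open>Uniqueness of the Jordan decomposition and transfer of null sets\<close>

lemma jordan_decomposition_uminus:
  "jordan_decomposition \<nu> M N \<Longrightarrow> jordan_decomposition (\<lambda>B. - \<nu> B) N M"
  unfolding jordan_decomposition_def by (auto intro!: bexI[of _ "- _"])

text \<open>On \<open>P\<close> the measure \<open>N\<close> vanishes and off \<open>P\<close> the
  measure \<open>M\<close> does. The formula for \<open>M\<close> carries properties of
  \<open>\<nu>\<close> over to its positive part.\<close>

lemma jordan_decomposition_positive_part:
  assumes "jordan_decomposition \<nu> M N"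
  obtains P where "P \<in> sets borel" "measure M (- P) = 0" "measure N P = 0"
    "\<And>B. B \<in> sets borel \<Longrightarrow> measure M B = \<nu> (B \<inter> P)"
proof -
  from assms obtain P where P: "P \<in> sets borel" "measure M (- P) = 0" "measure N P = 0"
    and fin: "finite_measure M" "finite_measure N"
    and sets: "sets M = sets borel" "sets N = sets borel"
    and \<nu>: "\<And>B. B \<in> sets borel \<Longrightarrow> \<nu> B = measure M B - measure N B"
    by (auto simp: jordan_decomposition_def)
  have "measure M B = \<nu> (B \<inter> P)" if B: "B \<in> sets borel" for B
  proof -
    have "measure M (B \<inter> - P) \<le> measure M (- P)"
      using P B by (intro finite_measure.finite_measure_mono[OF fin(1)]) (auto simp: sets)
    moreover have "measure N (B \<inter> P) \<le> measure N P"
      using P B by (intro finite_measure.finite_measure_mono[OF fin(2)]) (auto simp: sets)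
    ultimately have z: "measure M (B \<inter> - P) = 0" "measure N (B \<inter> P) = 0"
      using P measure_nonneg[of M "B \<inter> - P"] measure_nonneg[of N "B \<inter> P"] by linarith+
    have "measure M ((B \<inter> P) \<union> (B \<inter> - P)) = measure M (B \<inter> P) + measure M (B \<inter> - P)"
      using fin P B by (intro finite_measure.finite_measure_Union) (auto simp: sets)
    moreover have "(B \<inter> P) \<union> (B \<inter> - P) = B" by auto
    ultimately show ?thesis
      using z \<nu>[of "B \<inter> P"] P B by simp
  qed
  with P show thesis by (rule that)
qed

text \<open>\<open>M B\<close> is a value of \<open>\<nu>\<close> on a subset of \<open>B\<close>,
  and any other positive part dominates such values; then exchange the two decompositions.\<close>

lemma jordan_decomposition_unique_pos:
  assumes 1: "jordan_decomposition \<nu> M N" and 2: "jordan_decomposition \<nu> M' N'"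
  shows "M = M'"
proof -
  have le: "measure M B \<le> measure M' B"
    if 1: "jordan_decomposition \<nu> M N" and 2: "jordan_decomposition \<nu> M' N'"
      and B: "B \<in> sets borel" for M N M' N' :: "real measure" and B
  proof -
    obtain P where P: "P \<in> sets borel" "measure M B = \<nu> (B \<inter> P)"
      using jordan_decomposition_positive_part[OF 1] B by metis
    have "\<nu> (B \<inter> P) = measure M' (B \<inter> P) - measure N' (B \<inter> P)"
      using 2 P(1) B by (auto simp: jordan_decomposition_def)
    also have "\<dots> \<le> measure M' (B \<inter> P)"
      by simp
    also have "\<dots> \<le> measure M' B"
      using 2 P(1) B
      by (intro finite_measure.finite_measure_mono) (auto simp: jordan_decomposition_def)
    finally show ?thesis
      using P(2) by simp
  qed
  have "measure M B = measure M' B" if "B \<in> sets borel" for B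
    using le[OF 1 2 that] le[OF 2 1 that] by simp
  then show ?thesis
    using 1 2 by (intro measure_eqI)
      (auto simp: jordan_decomposition_def finite_measure.emeasure_eq_measure)
qed

lemma jordan_decomposition_unique:
  assumes "jordan_decomposition \<nu> M N" "jordan_decomposition \<nu> M' N'"
  shows "M = M'" "N = N'"
  using jordan_decomposition_unique_pos assms
    jordan_decomposition_unique_pos[OF jordan_decomposition_uminus jordan_decomposition_uminus]
  by blast+

text \<open>The part of \<open>- K\<close> inside the Hahn set avoids \<open>K\<close>, so
  \<open>\<nu>\<close> vanishes there, and its value is the mass that \<open>M\<close> gives to
  \<open>- K\<close>.\<close>

lemma jordan_decomposition_AE:
  assumes J: "jordan_decomposition \<nu> M N" and K: "K \<in> sets borel"
    and null: "\<And>B. B \<in> sets borel \<Longrightarrow> B \<inter> K = {} \<Longrightarrow> \<nu> B = 0"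
  shows "AE x in M. x \<in> K"
proof -
  obtain P where P: "P \<in> sets borel" "\<And>B. B \<in> sets borel \<Longrightarrow> measure M B = \<nu> (B \<inter> P)"
    using jordan_decomposition_positive_part[OF J] by metis
  have "measure M (- K) = \<nu> (- K \<inter> P)"
    using P K by auto
  also have "\<dots> = 0"
    using P K by (intro null) auto
  finally have "emeasure M (- K) = 0"
    using J by (simp add: jordan_decomposition_def finite_measure.emeasure_eq_measure)
  then show ?thesis
    using J K by (intro AE_I[of _ _ "- K"]) (auto simp: jordan_decomposition_def)
qed

lemma has_charge_integral_finite:
  assumes I: "has_charge_integral \<nu> f I" and T: "finite T"
    and null: "\<And>B. B \<in> sets borel \<Longrightarrow> B \<inter> T = {} \<Longrightarrow> \<nu> B = 0"
  shows "I = (\<Sum>x\<in>T. f x * \<nu> {x})"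
proof -
  from I obtain M N where J: "jordan_decomposition \<nu> M N"
    and int: "integrable M f" "integrable N f" and I: "I = integral\<^sup>L M f - integral\<^sup>L N f"
    by (auto simp: has_charge_integral_def)
  have T': "T \<in> sets borel"
    using T by (simp add: finite_imp_closed)
  \<comment> \<open>Both parts are concentrated on \<open>T\<close>, where \<open>f\<close> agrees
    with a simple function. The claim is general in \<open>\<nu>\<close>, so that it also serves
    \<open>N\<close>, the positive part of \<open>- \<nu>\<close>.\<close>
  have eq: "integral\<^sup>L M f = (\<Sum>x\<in>T. f x * measure M {x})"
    if J: "jordan_decomposition \<nu> M N" and int: "integrable M f"
      and null: "\<And>B. B \<in> sets borel \<Longrightarrow> B \<inter> T = {} \<Longrightarrow> \<nu> B = 0" for \<nu> M N
  proof -
    have fin: "finite_measure M" and sets: "sets M = sets borel"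
      using J by (auto simp: jordan_decomposition_def)
    have "AE x in M. x \<in> T"
      by (rule jordan_decomposition_AE[OF J T' null])
    then have "AE x in M. f x = (\<Sum>y\<in>T. f y * indicator {y} x)"
    proof eventually_elim
      case (elim x)
      have "(\<Sum>y\<in>T. f y * indicator {y} x) = (\<Sum>y\<in>T. if y = x then f y else 0)"
        by (intro sum.cong) auto
      then show ?case using elim T by simp
    qed
    moreover have ind: "integrable M (\<lambda>x. f y * indicator {y} x)" for y
      using fin sets
      by (intro integrable_mult_right integrable_real_indicator)
        (auto simp: finite_measure.emeasure_finite less_top[symmetric])
    ultimately have "integral\<^sup>L M f = (\<integral>x. (\<Sum>y\<in>T. f y * indicator {y} x) \<partial>M)"
      using int
      by (intro integral_cong_AE borel_measurable_integrable Bochner_Integration.integrable_sum)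
    also have "\<dots> = (\<Sum>y\<in>T. \<integral>x. f y * indicator {y} x \<partial>M)"
      using ind by (rule Bochner_Integration.integral_sum)
    also have "\<dots> = (\<Sum>x\<in>T. f x * measure M {x})"
      using sets by (simp add: sets_eq_imp_space_eq)
    finally show ?thesis .
  qed
  have "I = (\<Sum>x\<in>T. f x * measure M {x}) - (\<Sum>x\<in>T. f x * measure N {x})"
    unfolding I using eq[OF J int(1) null] eq[OF jordan_decomposition_uminus[OF J] int(2)] null
    by simp
  also have "\<dots> = (\<Sum>x\<in>T. f x * \<nu> {x})"
    using J by (simp add: jordan_decomposition_def right_diff_distrib sum_subtractf)
  finally show ?thesis .
qed

section \<open>Charges with vanishing moments\<close>

lemma integrable_continuous_compact:
  fixes f :: "real \<Rightarrow> real"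
  assumes "finite_measure M" "sets M = sets borel" "compact K" "AE x in M. x \<in> K"
    and "continuous_on UNIV f"
  shows "integrable M f"
proof -
  have "bounded (f ` K)"
    using assms by (intro compact_imp_bounded compact_continuous_image) (auto intro: continuous_on_subset)
  then obtain C where C: "\<And>x. x \<in> K \<Longrightarrow> norm (f x) \<le> C"
    by (auto simp: bounded_iff)
  have "f \<in> borel_measurable M"
    using borel_measurable_continuous_onI[OF assms(5)] measurable_cong_sets[OF assms(2) refl] by blast
  moreover have "AE x in M. norm (f x) \<le> C"
    using assms(4) by eventually_elim (rule C)
  ultimately show ?thesis
    using assms(1) by (intro finite_measure.integrable_const_bound)
qed

text \<open>\<open>M\<close> and \<open>N\<close> stand for the two parts of one charge. That the
  charge with density \<open>q\<close> has zero moments is expressed as equality of integrals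
  against two ordinary measures.\<close>

locale two_compact_measures =
  fixes M N :: "real measure" and K :: "real set"
  assumes finite_M: "finite_measure M" and finite_N: "finite_measure N"
    and sets_M: "sets M = sets borel" and sets_N: "sets N = sets borel"
    and compact: "compact K" and AE_M: "AE x in M. x \<in> K" and AE_N: "AE x in N. x \<in> K"
begin

lemma integrable_M: "continuous_on UNIV f \<Longrightarrow> integrable M (f :: real \<Rightarrow> real)"
  using integrable_continuous_compact[OF finite_M sets_M compact AE_M] .

lemma integrable_N: "continuous_on UNIV f \<Longrightarrow> integrable N (f :: real \<Rightarrow> real)"
  using integrable_continuous_compact[OF finite_N sets_N compact AE_N] .

lemma integral_eq_continuous:
  fixes f q :: "real \<Rightarrow> real"
  assumes q: "continuous_on UNIV q" and f: "continuous_on UNIV f"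
    and moments: "\<And>n. (\<integral>x. x ^ n * q x \<partial>M) = (\<integral>x. x ^ n * q x \<partial>N)"
  shows "(\<integral>x. f x * q x \<partial>M) = (\<integral>x. f x * q x \<partial>N)"
proof (rule ccontr)
  assume ne: "(\<integral>x. f x * q x \<partial>M) \<noteq> (\<integral>x. f x * q x \<partial>N)"
  define d where "d = \<bar>(\<integral>x. f x * q x \<partial>M) - (\<integral>x. f x * q x \<partial>N)\<bar>"
  define C where "C = (\<integral>x. \<bar>q x\<bar> \<partial>M) + (\<integral>x. \<bar>q x\<bar> \<partial>N)"
  \<comment> \<open>Approximating \<open>f\<close> within \<open>e\<close> on \<open>K\<close>
    changes the difference of the two integrals by at most \<open>e * C\<close>, which is less than
    \<open>d\<close>. The added 1 covers \<open>C = 0\<close>.\<close>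
  define e where "e = d / (C + 1)"
  have "C \<ge> 0" "d > 0"
    using ne by (auto simp: C_def d_def)
  then have "e > 0" by (simp add: e_def)
  obtain g where g: "real_polynomial_function g" "\<And>x. x \<in> K \<Longrightarrow> \<bar>f x - g x\<bar> < e"
    using Stone_Weierstrass_real_polynomial_function[OF compact continuous_on_subset[OF f] \<open>e > 0\<close>]
    by blast
  obtain a n where g_eq: "g = (\<lambda>x. \<Sum>i\<le>n. a i * x ^ i)"
    using g(1) by (auto simp: real_polynomial_function_iff_sum)
  have cont_g: "continuous_on UNIV g"
    unfolding g_eq by (intro continuous_intros)
  have gq: "(\<lambda>x. g x * q x) = (\<lambda>x. \<Sum>i\<le>n. a i * (x ^ i * q x))"
    by (simp add: g_eq sum_distrib_right mult.assoc)
  have "(\<integral>x. g x * q x \<partial>M) = (\<Sum>i\<le>n. a i * (\<integral>x. x ^ i * q x \<partial>M))"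
    unfolding gq
    by (subst Bochner_Integration.integral_sum) (auto intro!: integrable_M continuous_intros q)
  also have "\<dots> = (\<Sum>i\<le>n. a i * (\<integral>x. x ^ i * q x \<partial>N))"
    by (simp add: moments)
  also have "\<dots> = (\<integral>x. g x * q x \<partial>N)"
    unfolding gq
    by (subst Bochner_Integration.integral_sum) (auto intro!: integrable_N continuous_intros q)
  finally have g_MN: "(\<integral>x. g x * q x \<partial>M) = (\<integral>x. g x * q x \<partial>N)" .
  have bound: "\<bar>(\<integral>x. f x * q x \<partial>L) - (\<integral>x. g x * q x \<partial>L)\<bar> \<le> e * (\<integral>x. \<bar>q x\<bar> \<partial>L)"
    if int: "\<And>h :: real \<Rightarrow> real. continuous_on UNIV h \<Longrightarrow> integrable L h" and AE: "AE x in L. x \<in> K"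
    for L
  proof -
    have "(\<integral>x. f x * q x \<partial>L) - (\<integral>x. g x * q x \<partial>L) = (\<integral>x. f x * q x - g x * q x \<partial>L)"
      by (intro Bochner_Integration.integral_diff[symmetric] int continuous_intros f q cont_g)
    also have "\<bar>\<dots>\<bar> \<le> (\<integral>x. \<bar>f x * q x - g x * q x\<bar> \<partial>L)"
      by (rule integral_abs_bound)
    also have "\<dots> \<le> (\<integral>x. e * \<bar>q x\<bar> \<partial>L)"
    proof (rule integral_mono_AE)
      show "AE x in L. \<bar>f x * q x - g x * q x\<bar> \<le> e * \<bar>q x\<bar>"
        using AE
      proof eventually_elim
        case (elim x)
        then show ?case
          using g(2)[of x] by (simp add: left_diff_distrib[symmetric] abs_mult mult_right_mono)
      qed
    qed (intro int continuous_intros f q cont_g)+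
    also have "\<dots> = e * (\<integral>x. \<bar>q x\<bar> \<partial>L)"
      by simp
    finally show ?thesis .
  qed
  have "d \<le> e * C"
    using bound[OF integrable_M AE_M] bound[OF integrable_N AE_N] g_MN
    by (simp add: d_def C_def distrib_left)
  also have "\<dots> < d"
    using \<open>C \<ge> 0\<close> \<open>d > 0\<close> by (simp add: e_def field_simps)
  finally show False by simp
qed

text \<open>Open rays form an intersection-stable generator of the Borel sets. Their indicators are
  limits of continuous functions, and the sets satisfying the equality form a Dynkin system.\<close>

lemma set_integral_eq_borel:
  fixes q :: "real \<Rightarrow> real"
  assumes q: "continuous_on UNIV q"
    and moments: "\<And>n. (\<integral>x. x ^ n * q x \<partial>M) = (\<integral>x. x ^ n * q x \<partial>N)"
    and B: "B \<in> sets borel"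
  shows "(LINT x:B|M. q x) = (LINT x:B|N. q x)"
proof -
  have gen: "sets borel = sigma_sets UNIV (range (\<lambda>a::real. {a<..}))"
    by (subst borel_Ioi) simp
  have "{a<..} \<inter> {b<..} = {max a b<..}" for a b :: real
    by auto
  then have stable: "Int_stable (range (\<lambda>a::real. {a<..}))"
    by (auto simp: Int_stable_def)
  have int: "set_integrable M A q" "set_integrable N A q" if "A \<in> sets borel" for A
    unfolding set_integrable_def
    using that integrable_mult_indicator[OF _ integrable_M[OF q]]
      integrable_mult_indicator[OF _ integrable_N[OF q]] sets_M sets_N
    by blast+
  have space: "space M = UNIV" "space N = UNIV"
    using sets_M sets_N by (auto dest: sets_eq_imp_space_eq)
  have "range (\<lambda>a::real. {a<..}) \<subseteq> Pow UNIV"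
    by simp
  from stable this B[unfolded gen] show ?thesis
  proof (induction rule: sigma_sets_induct_disjoint)
    case (basic A)
    then obtain a :: real where A: "A = {a<..}" by auto
    \<comment> \<open>For \<open>k > 0\<close> a ramp that is 0 up to \<open>a\<close>, rises
      linearly, and is 1 from \<open>a + 1/k\<close> on.\<close>
    define f where "f k x = min 1 (max 0 (real k * (x - a)))" for k x
    have cont: "continuous_on UNIV (f k)" for k
      unfolding f_def by (intro continuous_intros)
    have lim: "(\<lambda>k. f k x * q x) \<longlonglongrightarrow> indicator A x * q x" for x
    proof (cases "x > a")
      case True
      obtain k0 :: nat where k0: "1 / (x - a) \<le> real k0"
        using real_arch_simple by blast
      have "f k x = 1" if "k \<ge> k0" for k
      proof -
        have "1 / (x - a) \<le> real k" using k0 that by linarith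
        then show ?thesis using True by (simp add: f_def field_simps)
      qed
      then have "eventually (\<lambda>k. f k x * q x = indicator A x * q x) sequentially"
        using True A by (auto intro: eventually_sequentiallyI[of k0])
      then show ?thesis by (rule tendsto_eventually)
    next
      case False
      then have "f k x = 0" for k
        by (simp add: f_def mult_nonneg_nonpos max_absorb1)
      then show ?thesis using False A by simp
    qed
    have conv: "(\<lambda>k. \<integral>x. f k x * q x \<partial>L) \<longlonglongrightarrow> (LINT x:A|L. q x)"
      if sets: "sets L = sets borel" and int: "\<And>h :: real \<Rightarrow> real. continuous_on UNIV h \<Longrightarrow> integrable L h"
      for L
      unfolding set_lebesgue_integral_def real_scaleR_def
    proof (rule integral_dominated_convergence)
      show "(\<lambda>x. indicator A x * q x) \<in> borel_measurable L"
        using int[OF q] sets by (intro borel_measurable_times borel_measurable_indicator) (auto simp: A)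
      show "(\<lambda>x. f k x * q x) \<in> borel_measurable L" for k
        using int[OF continuous_on_mult[OF cont q]] by (rule borel_measurable_integrable)
      show "integrable L (\<lambda>x. \<bar>q x\<bar>)"
        using int q by (intro integrable_abs)
      show "AE x in L. norm (f k x * q x) \<le> \<bar>q x\<bar>" for k
        by (auto simp: f_def abs_mult intro!: AE_I2 mult_left_le_one_le)
    qed (use lim in auto)
    have "(\<integral>x. f k x * q x \<partial>M) = (\<integral>x. f k x * q x \<partial>N)" for k
      by (rule integral_eq_continuous[OF q cont moments])
    then show ?case
      using conv[OF sets_M integrable_M] conv[OF sets_N integrable_N] LIMSEQ_unique by simp
  next
    case empty
    show ?case by (simp add: set_lebesgue_integral_def)
  next
    case (compl A)
    then have A: "A \<in> sets borel" "UNIV - A \<in> sets borel" by (auto simp: gen[symmetric])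
    have split: "(LINT x:UNIV - A|L. q x) = (LINT x|L. q x) - (LINT x:A|L. q x)"
      if "set_integrable L A q" "set_integrable L (UNIV - A) q" "space L = UNIV" for L
      using set_integral_Un[of A "UNIV - A" L q] that
      by (simp add: set_lebesgue_integral_def)
    \<comment> \<open>The moment of order 0 compares the integrals over the whole line.\<close>
    have "(LINT x|M. q x) = (LINT x|N. q x)"
      using moments[of 0] by simp
    then show ?case
      using split[OF int(1)[OF A(1)] int(1)[OF A(2)] space(1)]
        split[OF int(2)[OF A(1)] int(2)[OF A(2)] space(2)] compl.IH by simp
  next
    case (union A)
    then have A: "\<And>i. A i \<in> sets borel" by (auto simp: gen[symmetric])
    have disj: "A i \<inter> A j = {}" if "i \<noteq> j" for i j
      using union(1) that by (auto simp: disjoint_family_on_def)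
    have "(\<Union>i. A i) \<in> sets borel" using A by auto
    then show ?case
      using lebesgue_integral_countable_add[OF _ disj int(1)[of "\<Union>i. A i"]]
        lebesgue_integral_countable_add[OF _ disj int(2)[of "\<Union>i. A i"]] A sets_M sets_N union.IH
      by simp
  qed
qed

end

text \<open>The weighted measures \<open>q M\<close> and \<open>q N\<close> agree on all Borel sets,
  yet \<open>M\<close> lives on \<open>P\<close> and \<open>N\<close> off \<open>P\<close>, so both
  must be zero.\<close>

lemma vanishing_moments_imp_AE_zero:
  fixes q :: "real \<Rightarrow> real"
  assumes J: "jordan_decomposition \<nu> M N" and K: "compact K"
    and null: "\<And>B. B \<in> sets borel \<Longrightarrow> B \<inter> K = {} \<Longrightarrow> \<nu> B = 0"
    and q: "continuous_on UNIV q"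
    and moments: "\<And>n. (\<integral>x. x ^ n * q x \<partial>M) = (\<integral>x. x ^ n * q x \<partial>N)"
  shows "AE x in M. q x = 0"
proof -
  have K': "K \<in> sets borel"
    using K by (simp add: compact_imp_closed)
  have AE_M: "AE x in M. x \<in> K"
    by (rule jordan_decomposition_AE[OF J K' null])
  have AE_N: "AE x in N. x \<in> K"
    by (rule jordan_decomposition_AE[OF jordan_decomposition_uminus[OF J] K']) (simp add: null)
  have "finite_measure M" "finite_measure N" "sets M = sets borel" "sets N = sets borel"
    using J unfolding jordan_decomposition_def by blast+
  then interpret two_compact_measures M N K
    using K AE_M AE_N by (intro two_compact_measures.intro)
  obtain P where P: "P \<in> sets borel" "measure M (- P) = 0" "measure N P = 0"
    using jordan_decomposition_positive_part[OF J] by metis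
  have P_M: "AE x in M. x \<in> P"
    using P finite_M sets_M
    by (intro AE_I[of _ _ "- P"]) (auto simp: finite_measure.emeasure_eq_measure)
  have P_N: "AE x in N. x \<notin> P"
    using P finite_N sets_N
    by (intro AE_I[of _ _ P]) (auto simp: finite_measure.emeasure_eq_measure)
  have half: "AE x in M. s * q x \<le> 0" for s :: real
  proof -
    \<comment> \<open>On this set \<open>s * q\<close> is positive and \<open>N\<close> has no mass,
      so the \<open>M\<close>-integral of a nonnegative function vanishes. The values 1 and -1 of
      \<open>s\<close> treat the two signs of \<open>q\<close>.\<close>
    define B where "B = P \<inter> {x. s * q x > 0}"
    have "open {x. s * q x > 0}"
      by (intro open_Collect_less continuous_intros q)
    then have B: "B \<in> sets borel"
      using P by (auto simp: B_def)
    have int: "integrable M (\<lambda>x. indicator B x * (s * q x))"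
      using integrable_mult_indicator[of B M "\<lambda>x. s * q x"] integrable_M[OF continuous_on_mult_left[OF q]]
        B sets_M by simp
    have "(LINT x:B|N. q x) = (\<integral>x. 0 \<partial>N)"
      unfolding set_lebesgue_integral_def
    proof (rule integral_cong_AE)
      show "AE x in N. indicator B x *\<^sub>R q x = 0"
        using P_N by eventually_elim (auto simp: B_def)
      show "(\<lambda>x. indicator B x *\<^sub>R q x) \<in> borel_measurable N"
        using integrable_N[OF q] B sets_N
        by (intro borel_measurable_scaleR borel_measurable_indicator) auto
    qed simp
    then have "(LINT x:B|M. q x) = 0"
      using set_integral_eq_borel[OF q moments B] by simp
    moreover have "(\<integral>x. indicator B x * (s * q x) \<partial>M) = s * (LINT x:B|M. q x)"
      unfolding set_lebesgue_integral_def by (simp flip: integral_mult_right_zero add: mult_ac)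
    ultimately have "(\<integral>x. indicator B x * (s * q x) \<partial>M) = 0"
      by simp
    then have "AE x in M. indicator B x * (s * q x) = 0"
      using int by (subst (asm) integral_nonneg_eq_0_iff_AE) (auto simp: B_def indicator_def)
    then show ?thesis
      using P_M by eventually_elim (auto simp: B_def indicator_def split: if_splits)
  qed
  show ?thesis
    using half[of 1] half[of "-1"] by eventually_elim simp
qed

lemma vanishing_moments_imp_null:
  fixes q :: "real \<Rightarrow> real"
  assumes J: "jordan_decomposition \<nu> M N" and K: "compact K"
    and null: "\<And>B. B \<in> sets borel \<Longrightarrow> B \<inter> K = {} \<Longrightarrow> \<nu> B = 0"
    and q: "continuous_on UNIV q"
    and moments: "\<And>n. (\<integral>x. x ^ n * q x \<partial>M) = (\<integral>x. x ^ n * q x \<partial>N)"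
    and B: "B \<in> sets borel" "B \<inter> {x. q x = 0} = {}"
  shows "\<nu> B = 0"
proof -
  have zero: "measure L B = 0" if "AE x in L. q x = 0" "sets L = sets borel" for L
  proof -
    have "AE x in L. x \<notin> B"
      using that(1) by eventually_elim (use B in auto)
    then have "emeasure L B = 0"
      using B that(2) by (subst (asm) AE_iff_measurable[of B])
        (auto dest: sets_eq_imp_space_eq)
    then show ?thesis by (simp add: measure_def)
  qed
  have "AE x in M. q x = 0"
    using vanishing_moments_imp_AE_zero[OF J K null q moments] .
  moreover have "AE x in N. q x = 0"
    using vanishing_moments_imp_AE_zero[OF jordan_decomposition_uminus[OF J] K _ q moments[symmetric]] null
    by simp
  ultimately show ?thesis
    using J B zero by (simp add: jordan_decomposition_def)
qed

text \<open>Entrywise, the moments of the charge with density \<open>Q\<close> are the entries of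
  \<open>shift_apply Q S\<close>, hence zero.\<close>

lemma representing_charge_null_outside_zeros:
  fixes S :: "nat \<Rightarrow> real ^ 'p ^ 'p"
  assumes rep: "representing_charge \<mu> S" and K: "compact (charge_support \<mu>)"
    and ann: "annihilates Q S"
  shows "charge_null_outside \<mu> {x. poly Q x = 0}"
proof -
  have charge: "matrix_charge \<mu>"
    using rep by (simp add: representing_charge_def)
  have "\<mu> B $ i $ j = 0" if B: "B \<in> sets borel" "B \<inter> {x. poly Q x = 0} = {}" for B i j
  proof -
    let ?\<nu> = "\<lambda>B. \<mu> B $ i $ j"
    have integral: "has_charge_integral ?\<nu> (\<lambda>x. x ^ n) (S n $ i $ j)" for n
      using rep by (simp add: representing_charge_def has_matrix_charge_integral_def)
    obtain M N where J: "jordan_decomposition ?\<nu> M N"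
      using integral[of 0] by (auto simp: has_charge_integral_def)
    \<comment> \<open>Each moment brings its own Jordan pair; by uniqueness all of them are the pair
      found at order 0.\<close>
    have moment: "integrable M (\<lambda>x. x ^ n)" "integrable N (\<lambda>x. x ^ n)"
      "S n $ i $ j = (\<integral>x. x ^ n \<partial>M) - (\<integral>x. x ^ n \<partial>N)" for n
      using integral[of n] jordan_decomposition_unique[OF J]
      by (auto simp: has_charge_integral_def)
    have expand: "(\<integral>x. x ^ n * poly Q x \<partial>L) = (\<Sum>k\<le>degree Q. coeff Q k * (\<integral>x. x ^ (n + k) \<partial>L))"
      if "\<And>n. integrable L (\<lambda>x. x ^ n)" for L and n
    proof -
      have "(\<lambda>x. x ^ n * poly Q x) = (\<lambda>x. \<Sum>k\<le>degree Q. coeff Q k * x ^ (n + k))"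
        by (simp add: poly_altdef sum_distrib_left power_add mult_ac)
      then show ?thesis
        using that by (simp add: Bochner_Integration.integral_sum)
    qed
    have "(\<integral>x. x ^ n * poly Q x \<partial>M) - (\<integral>x. x ^ n * poly Q x \<partial>N)
        = (\<Sum>k\<le>degree Q. coeff Q k * S (n + k) $ i $ j)" for n
      by (simp add: expand moment right_diff_distrib sum_subtractf)
    also have "\<dots> n = shift_apply Q S n $ i $ j" for n
      by (simp add: shift_apply_def)
    finally have "(\<integral>x. x ^ n * poly Q x \<partial>M) = (\<integral>x. x ^ n * poly Q x \<partial>N)" for n
      using ann by (simp add: annihilates_def)
    moreover have "?\<nu> A = 0" if "A \<in> sets borel" "A \<inter> charge_support \<mu> = {}" for A
      using charge_null_outside_support(2)[OF charge] that
      by (auto simp: charge_null_outside_def disjoint_eq_subset_Compl)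
    moreover have "continuous_on UNIV (poly Q)"
      by (intro continuous_intros)
    ultimately show ?thesis
      using vanishing_moments_imp_null[OF J K, of "poly Q" B] B by blast
  qed
  then show ?thesis
    by (auto simp: charge_null_outside_def vec_eq_iff disjoint_eq_subset_Compl)
qed

section \<open>Finitely supported charges\<close>

text \<open>The image under \<open>id\<close> moves \<open>point_measure Z\<close>, which lives on
  the subsets of \<open>Z\<close>, to the Borel sets of the line.\<close>

definition atomic_measure :: "real set \<Rightarrow> (real \<Rightarrow> real) \<Rightarrow> real measure" where
  "atomic_measure Z c = distr (point_measure Z (\<lambda>x. ennreal (c x))) borel id"

lemma sets_atomic_measure [simp]: "sets (atomic_measure Z c) = sets borel"
  by (simp add: atomic_measure_def)

lemma emeasure_atomic_measure:
  assumes "finite Z" "B \<in> sets borel"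
  shows "emeasure (atomic_measure Z c) B = (\<Sum>x\<in>B \<inter> Z. ennreal (c x))"
  using assms unfolding atomic_measure_def
  by (subst emeasure_distr) (auto simp: space_point_measure emeasure_point_measure_finite)

lemma finite_measure_atomic_measure: "finite Z \<Longrightarrow> finite_measure (atomic_measure Z c)"
  by (intro finite_measureI) (simp add: emeasure_atomic_measure sets_eq_imp_space_eq[OF sets_atomic_measure])

lemma measure_atomic_measure:
  assumes "finite Z" "B \<in> sets borel" "\<And>x. c x \<ge> 0"
  shows "measure (atomic_measure Z c) B = (\<Sum>x\<in>B \<inter> Z. c x)"
  using assms by (simp add: measure_def emeasure_atomic_measure sum_ennreal sum_nonneg)

lemma integral_atomic_measure:
  fixes f :: "real \<Rightarrow> real"
  assumes "finite Z" "f \<in> borel_measurable borel" "\<And>x. c x \<ge> 0"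
  shows "integrable (atomic_measure Z c) f"
    and "integral\<^sup>L (atomic_measure Z c) f = (\<Sum>x\<in>Z. c x * f x)"
  using assms unfolding atomic_measure_def
  by (auto simp: integrable_distr_eq integral_distr lebesgue_integral_point_measure_finite
      integrable_point_measure_finite)

text \<open>The positive and negative parts of the masses give the Jordan decomposition, with the
  points of positive mass as Hahn set.\<close>

lemma has_charge_integral_atomic:
  fixes f c :: "real \<Rightarrow> real"
  assumes Z: "finite Z" and f: "f \<in> borel_measurable borel"
  shows "has_charge_integral (\<lambda>B. \<Sum>x\<in>B \<inter> Z. c x) f (\<Sum>x\<in>Z. c x * f x)"
  unfolding has_charge_integral_def
proof (intro exI conjI)
  let ?p = "\<lambda>x. max (c x) 0" and ?n = "\<lambda>x. max (- c x) 0"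
  let ?M = "atomic_measure Z ?p" and ?N = "atomic_measure Z ?n"
  let ?P = "{x \<in> Z. c x > 0}"
  have diff: "c x = ?p x - ?n x" for x
    by (simp add: max_def)
  have P: "?P \<in> sets borel"
    using Z by (simp add: finite_imp_closed)
  show "jordan_decomposition (\<lambda>B. \<Sum>x\<in>B \<inter> Z. c x) ?M ?N"
    unfolding jordan_decomposition_def
  proof (intro conjI ballI bexI[OF _ P])
    show "measure ?M (- ?P) = 0" "measure ?N ?P = 0"
      using Z P by (auto simp: measure_atomic_measure intro!: sum.neutral)
    show "(\<Sum>x\<in>B \<inter> Z. c x) = measure ?M B - measure ?N B" if "B \<in> sets borel" for B
      using Z that
      by (simp add: measure_atomic_measure sum_subtractf[symmetric] diff[symmetric])
  qed (use Z in \<open>auto intro: finite_measure_atomic_measure\<close>)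
  show "integrable ?M f" "integrable ?N f"
    using Z f by (auto intro: integral_atomic_measure)
  show "(\<Sum>x\<in>Z. c x * f x) = integral\<^sup>L ?M f - integral\<^sup>L ?N f"
    using Z f by (simp add: integral_atomic_measure sum_subtractf[symmetric]
        left_diff_distrib[symmetric] diff[symmetric])
qed

lemma scalar_charge_atomic:
  assumes Z: "finite Z"
  shows "scalar_charge (\<lambda>B. \<Sum>x\<in>B \<inter> Z. c x)"
  unfolding scalar_charge_def
proof (intro allI impI)
  fix A :: "nat \<Rightarrow> real set" assume A: "disjoint_family A"
  \<comment> \<open>Over the fixed index set \<open>Z\<close>, countable additivity reduces to
    single points, each of which lies in at most one \<open>A n\<close>.\<close>
  have eq: "(\<Sum>x\<in>B \<inter> Z. c x) = (\<Sum>x\<in>Z. if x \<in> B then c x else 0)" for B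
    using Z by (simp add: sum.If_cases Int_commute)
  show "(\<lambda>n. \<Sum>x\<in>A n \<inter> Z. c x) sums (\<Sum>x\<in>(\<Union>n. A n) \<inter> Z. c x)"
    unfolding eq
  proof (rule sums_sum)
    fix x
    show "(\<lambda>n. if x \<in> A n then c x else 0) sums (if x \<in> (\<Union>n. A n) then c x else 0)"
    proof (cases "x \<in> (\<Union>n. A n)")
      case True
      then obtain m where "x \<in> A m" by auto
      then have "(\<lambda>n. if x \<in> A n then c x else 0) = (\<lambda>n. if n = m then c x else 0)"
        using A by (auto simp: disjoint_family_on_def fun_eq_iff)
      then show ?thesis
        using True sums_single[of m "\<lambda>_. c x"] by simp
    qed auto
  qed
qed

text \<open>\<open>C x\<close> is the mass at \<open>x\<close>. Some masses may be zero, so the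
  support is only located inside \<open>Z\<close>, which is enough for compactness.\<close>

lemma representing_charge_exponential_sum:
  fixes S :: "nat \<Rightarrow> real ^ 'p ^ 'p"
  assumes Z: "finite Z" and S: "\<And>n. S n = (\<Sum>x\<in>Z. x ^ n *\<^sub>R C x)"
  defines "\<mu> \<equiv> \<lambda>B. \<Sum>x\<in>B \<inter> Z. C x"
  shows "representing_charge \<mu> S" and "compact (charge_support \<mu>)"
proof -
  have entry: "(\<lambda>B. \<mu> B $ i $ j) = (\<lambda>B. \<Sum>x\<in>B \<inter> Z. C x $ i $ j)" for i j
    by (simp add: \<mu>_def)
  have charge: "matrix_charge \<mu>"
    unfolding matrix_charge_def entry using scalar_charge_atomic[OF Z] by blast
  have "S n $ i $ j = (\<Sum>x\<in>Z. C x $ i $ j * x ^ n)" for n i j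
    by (simp add: S mult.commute)
  then have "has_matrix_charge_integral \<mu> (\<lambda>x. x ^ n) (S n)" for n
    unfolding has_matrix_charge_integral_def entry
    using has_charge_integral_atomic[OF Z, of "\<lambda>x. x ^ n"] by simp
  with charge show "representing_charge \<mu> S"
    by (simp add: representing_charge_def)
  have "charge_null_outside \<mu> Z"
    by (auto simp: charge_null_outside_def \<mu>_def intro!: sum.neutral)
  then have "charge_support \<mu> \<subseteq> Z"
    using charge_null_outside_support(3)[OF charge] Z by (simp add: finite_imp_closed)
  then show "compact (charge_support \<mu>)"
    using Z by (intro finite_imp_compact) (rule finite_subset)
qed

lemma representing_charge_finite_support:
  fixes S :: "nat \<Rightarrow> real ^ 'p ^ 'p"
  assumes rep: "representing_charge \<mu> S" and T: "finite (charge_support \<mu>)"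
  shows "S n = (\<Sum>x\<in>charge_support \<mu>. x ^ n *\<^sub>R \<mu> {x})"
proof -
  have charge: "matrix_charge \<mu>"
    using rep by (simp add: representing_charge_def)
  have "S n $ i $ j = (\<Sum>x\<in>charge_support \<mu>. x ^ n * \<mu> {x} $ i $ j)" for i j
  proof (rule has_charge_integral_finite)
    show "has_charge_integral (\<lambda>B. \<mu> B $ i $ j) (\<lambda>x. x ^ n) (S n $ i $ j)"
      using rep by (simp add: representing_charge_def has_matrix_charge_integral_def)
    show "\<mu> B $ i $ j = 0" if "B \<in> sets borel" "B \<inter> charge_support \<mu> = {}" for B
      using charge_null_outside_support(2)[OF charge] that
      by (auto simp: charge_null_outside_def disjoint_eq_subset_Compl)
  qed (rule T)
  then show ?thesis
    by (simp add: vec_eq_iff)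
qed

text \<open>Compactness enters both claims: for arbitrary charges, Boas' theorem applied to each
  entry represents every matrix sequence, including those with minimal polynomial X^2 + 1.\<close>

theorem theorem3p8:
  fixes S :: "nat \<Rightarrow> real ^ 'p ^ 'p"
  assumes "linearly_recursive S"
  shows "((\<exists>\<mu>. representing_charge \<mu> S \<and> compact (charge_support \<mu>))
            \<longleftrightarrow> real_distinct_roots (minimal_poly S))
       \<and> (\<forall>\<mu>. representing_charge \<mu> S \<and> compact (charge_support \<mu>)
            \<longrightarrow> charge_support \<mu> = {x. poly (minimal_poly S) x = 0})"
proof -
  define P where "P = minimal_poly S"
  have P: "lead_coeff P = 1" "annihilates Q S \<longleftrightarrow> P dvd Q" for Q
    using minimal_poly[OF assms] by (simp_all add: P_def)
  then have "P \<noteq> 0" by auto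
  then have finite: "finite {x. poly P x = 0}"
    by (rule poly_roots_finite)
  have forward: "real_distinct_roots P \<and> charge_support \<mu> = {x. poly P x = 0}"
    if \<mu>: "representing_charge \<mu> S" "compact (charge_support \<mu>)" for \<mu>
  proof -
    have "charge_null_outside \<mu> {x. poly P x = 0}"
      by (rule representing_charge_null_outside_zeros[OF \<mu>]) (simp add: P)
    then have sub: "charge_support \<mu> \<subseteq> {x. poly P x = 0}"
      using \<mu>(1) finite
      by (intro charge_null_outside_support(3)) (auto simp: representing_charge_def finite_imp_closed)
    then have fin: "finite (charge_support \<mu>)"
      using finite by (rule finite_subset)
    \<comment> \<open>Divisibility by \<open>P\<close> yields the real distinct roots and, at once,
      the inclusion of the zeros of \<open>P\<close> in the support.\<close>
    have "annihilates (\<Prod>x\<in>charge_support \<mu>. [:-x, 1:]) S"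
      using fin representing_charge_finite_support[OF \<mu>(1) fin]
      by (rule exponential_sum_imp_annihilates_prod)
    then have "P dvd (\<Prod>x\<in>charge_support \<mu>. [:-x, 1:])"
      by (simp add: P)
    from real_distinct_roots_dvd_prod[OF fin this] sub show ?thesis
      by auto
  qed
  have "\<exists>\<mu>. representing_charge \<mu> S \<and> compact (charge_support \<mu>)" if "real_distinct_roots P"
  proof -
    have "annihilates (\<Prod>x\<in>{x. poly P x = 0}. [:-x, 1:]) S"
      using real_distinct_roots_eq_prod[OF P(1) that] P(2) by (metis dvd_refl)
    then obtain C where "\<And>n. S n = (\<Sum>x\<in>{x. poly P x = 0}. x ^ n *\<^sub>R C x)"
      using annihilates_prod_imp_exponential_sum[OF finite] by blast
    from representing_charge_exponential_sum[OF finite this] show ?thesis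
      by blast
  qed
  with forward show ?thesis
    unfolding P_def by blast
qed

end
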